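(* Locally Minimal Defensive Alliance on triangle-free graphs of minimum degree at least 2 admits a kernel with at most $k^{\mathcal{O}(k^2)}$ vertices.
   Context: Let $G=(V,E)$ be a finite, simple, undirected graph. For $D\subseteq V$ and $v\in V$, let $d_D(v)$ denote the number of neighbours of $v$ in $D$, and $D^c=V\setminus D$. A non-empty set $D\subseteq V$ is a defensive alliance in $G$ if for each $v\in D$, $d_D(v)+1\geq d_{D^c}(v)$. A defensive alliance $D$ is locally minimal if for every $v\in D$, $D\setminus\{v\}$ is not a defensive alliance. The problem Locally Minimal Defensive Alliance is: given a graph $G$ and an integer $k$, does $G$ have a locally minimal defensive alliance $D$ with $|D|\geq k$? The parameter is the solution size $k$. *)

theory Defs
  imports
    Complex_Main
    "HOL-Library.Landau_Symbols"
    "HOL-Computational_Algebra.Polynomial"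
begin

section \<open>Graphs and defensive alliances\<close>

definition simple_graph :: "'a set \<Rightarrow> 'a set set \<Rightarrow> bool" where
  "simple_graph V E \<longleftrightarrow> finite V \<and> (\<forall>e\<in>E. e \<subseteq> V \<and> card e = 2)"

definition deg_in :: "'a set set \<Rightarrow> 'a set \<Rightarrow> 'a \<Rightarrow> nat" where
  "deg_in E D v = card {u \<in> D. {u, v} \<in> E}"

definition triangle_free :: "'a set set \<Rightarrow> bool" where
  "triangle_free E \<longleftrightarrow> \<not> (\<exists>u v w. {u, v} \<in> E \<and> {v, w} \<in> E \<and> {u, w} \<in> E)"

definition min_degree_at_least :: "nat \<Rightarrow> 'a set \<Rightarrow> 'a set set \<Rightarrow> bool" where
  "min_degree_at_least d V E \<longleftrightarrow> (\<forall>v\<in>V. d \<le> deg_in E V v)"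

definition defensive_alliance :: "'a set \<Rightarrow> 'a set set \<Rightarrow> 'a set \<Rightarrow> bool" where
  "defensive_alliance V E D \<longleftrightarrow>
     D \<noteq> {} \<and> D \<subseteq> V \<and> (\<forall>v\<in>D. deg_in E D v + 1 \<ge> deg_in E (V - D) v)"

definition locally_minimal_defensive_alliance :: "'a set \<Rightarrow> 'a set set \<Rightarrow> 'a set \<Rightarrow> bool" where
  "locally_minimal_defensive_alliance V E D \<longleftrightarrow>
     defensive_alliance V E D \<and> (\<forall>v\<in>D. \<not> defensive_alliance V E (D - {v}))"

section \<open>Polynomial-time computability\<close>

text \<open>
  Deterministic multi-tape Turing machines with two-way infinite tapes over the tape alphabet
  \<open>{0, 1, blank}\<close>; \<^term>\<open>None\<close> is the blank. The states are \<open>0, \<dots>, states M\<close>, where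
  \<open>0\<close> is initial and \<open>states M\<close> is the unique halting state. Tape \<open>0\<close> holds the input,
  tape \<open>1\<close> the output.
\<close>

datatype head_move = Go_Left | Stay | Go_Right

fun offset :: "head_move \<Rightarrow> int" where
  "offset Go_Left = -1"
| "offset Stay = 0"
| "offset Go_Right = 1"

record tm =
  tapes :: nat
  states :: nat
  delta :: "nat \<Rightarrow> bool option list \<Rightarrow> nat \<times> (bool option \<times> head_move) list"

definition tm_wf :: "tm \<Rightarrow> bool" where
  "tm_wf M \<longleftrightarrow> 2 \<le> tapes M \<and>
     (\<forall>q < states M. \<forall>ss. length ss = tapes M \<longrightarrow>
        fst (delta M q ss) \<le> states M \<and> length (snd (delta M q ss)) = tapes M)"

type_synonym tape = "int \<times> (int \<Rightarrow> bool option)"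
type_synonym config = "nat \<times> tape list"

definition tape_read :: "tape \<Rightarrow> bool option" where
  "tape_read T = snd T (fst T)"

definition tape_act :: "bool option \<times> head_move \<Rightarrow> tape \<Rightarrow> tape" where
  "tape_act a T = (fst T + offset (snd a), (snd T)(fst T := fst a))"

definition tm_step :: "tm \<Rightarrow> config \<Rightarrow> config" where
  "tm_step M c =
     (if fst c < states M
      then let r = delta M (fst c) (map tape_read (snd c))
           in (fst r, map2 tape_act (snd r) (snd c))
      else c)"

definition word_on_tape :: "bool list \<Rightarrow> int \<Rightarrow> bool option" where
  "word_on_tape w i = (if 0 \<le> i \<and> i < int (length w) then Some (w ! nat i) else None)"

definition tm_init :: "tm \<Rightarrow> bool list \<Rightarrow> config" where
  "tm_init M w = (0, (0, word_on_tape w) # replicate (tapes M - 1) (0, word_on_tape []))"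

definition tm_outputs_within :: "tm \<Rightarrow> bool list \<Rightarrow> nat \<Rightarrow> bool list \<Rightarrow> bool" where
  "tm_outputs_within M w t v \<longleftrightarrow>
     (let c = (tm_step M ^^ t) (tm_init M w)
      in fst c = states M \<and> snd (snd c ! 1) = word_on_tape v)"

definition poly_time_computable_on ::
  "'a set \<Rightarrow> ('a \<Rightarrow> bool list) \<Rightarrow> ('b \<Rightarrow> bool list) \<Rightarrow> ('a \<Rightarrow> 'b) \<Rightarrow> bool" where
  "poly_time_computable_on X enc enc' F \<longleftrightarrow>
     (\<exists>M (p :: nat poly). tm_wf M \<and>
        (\<forall>x\<in>X. tm_outputs_within M (enc x) (poly p (length (enc x))) (enc' (F x))))"

section \<open>Kernels\<close>

text \<open>
  A parameterized problem is given by its set \<open>X\<close> of instances, their encoding \<open>enc\<close>, the set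
  \<open>Yes\<close> of yes-instances and the parameter \<open>par\<close>. The size of the reduced instance is
  measured by \<open>msr\<close> (the number of vertices, for graph problems).
\<close>

definition kernelization ::
  "'a set \<Rightarrow> ('a \<Rightarrow> bool list) \<Rightarrow> 'a set \<Rightarrow> ('a \<Rightarrow> nat) \<Rightarrow> ('a \<Rightarrow> nat) \<Rightarrow> (nat \<Rightarrow> nat)
     \<Rightarrow> ('a \<Rightarrow> 'a) \<Rightarrow> bool" where
  "kernelization X enc Yes par msr f K \<longleftrightarrow>
     poly_time_computable_on X enc enc K \<and>
     (\<forall>x\<in>X. K x \<in> X \<and> (K x \<in> Yes \<longleftrightarrow> x \<in> Yes) \<and>
        msr (K x) \<le> f (par x) \<and> par (K x) \<le> f (par x))"

definition admits_kernel ::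
  "'a set \<Rightarrow> ('a \<Rightarrow> bool list) \<Rightarrow> 'a set \<Rightarrow> ('a \<Rightarrow> nat) \<Rightarrow> ('a \<Rightarrow> nat) \<Rightarrow> (nat \<Rightarrow> nat) \<Rightarrow> bool" where
  "admits_kernel X enc Yes par msr f \<longleftrightarrow> (\<exists>K. kernelization X enc Yes par msr f K)"

section \<open>The problem Locally Minimal Defensive Alliance\<close>

text \<open>An instance \<open>(n, E, k)\<close> consists of the graph on \<open>{0, \<dots>, n - 1}\<close> with edge set \<open>E\<close> and of \<open>k\<close>.\<close>

type_synonym lmda_instance = "nat \<times> nat set set \<times> nat"

fun lmda_vertices :: "lmda_instance \<Rightarrow> nat" where
  "lmda_vertices (n, E, k) = n"

fun lmda_param :: "lmda_instance \<Rightarrow> nat" where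
  "lmda_param (n, E, k) = k"

text \<open>
  \<open>k\<close> and \<open>n\<close> in unary, followed by the adjacency matrix row by row. As usual for parameterized
  problems, the parameter counts with its value towards the input length.
\<close>

fun lmda_encode :: "lmda_instance \<Rightarrow> bool list" where
  "lmda_encode (n, E, k) =
     replicate k True @ [False] @ replicate n True @ [False] @
     concat (map (\<lambda>i. map (\<lambda>j. {i, j} \<in> E) [0..<n]) [0..<n])"

definition lmda_yes :: "lmda_instance set" where
  "lmda_yes = {(n, E, k). \<exists>D. locally_minimal_defensive_alliance {0..<n} E D \<and> card D \<ge> k}"

definition lmda_triangle_free_min_deg_2 :: "lmda_instance set" where
  "lmda_triangle_free_min_deg_2 =
     {(n, E, k). simple_graph {0..<n} E \<and> triangle_free E \<and> min_degree_at_least 2 {0..<n} E}"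

end

theory Submission
  imports Defs "HOL-Real_Asymp.Real_Asymp"
begin

text \<open>
  Every triangle-free graph of minimum degree at least 2 with at least \<open>max 1 (k (4k\<^sup>2 + 2)\<^sup>4)\<close>
  vertices is a yes-instance, so a kernelization only has to replace large instances by a fixed one.

  Call a vertex \<open>w\<close> of an alliance \<open>D\<close> marginal if \<open>D\<close> stops being an alliance when a neighbour of
  \<open>w\<close> is removed. Let \<open>S\<close> be a set of vertices at pairwise distance at least 5, \<open>D\<close> a smallest
  alliance containing \<open>S\<close>, and \<open>R\<close> the set of those \<open>v \<in> S\<close> without marginal neighbours. Every
  vertex of \<open>D - N[R]\<close> has a marginal neighbour in \<open>D - N[R]\<close>, so these vertices survive when \<open>D\<close>
  is shrunk to a locally minimal alliance \<open>D'\<close>. For \<open>v \<in> R\<close> each neighbour \<open>u \<in> D\<close> of \<open>v\<close> is not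
  marginal, hence has a second neighbour in \<open>D\<close>, which lies in \<open>D - N[R]\<close> as there are no triangles.
  Thus \<open>D'\<close> has a vertex at distance at most 2 from each \<open>v \<in> S\<close>, and \<open>|D'| \<ge> |S|\<close>.
  If some degree exceeds \<open>4k\<^sup>2 + 1\<close>, the same argument with a singleton \<open>S\<close> puts a vertex of degree
  greater than \<open>2k\<close> into \<open>D'\<close> or yields \<open>|D'| \<ge> k\<close> directly; otherwise a large graph contains a
  suitable \<open>S\<close> of size \<open>k\<close>.

  The threshold is rounded up to \<open>2^(c + k)\<close>: a Turing machine compares \<open>n\<close> with it by
  incrementing a binary counter of \<open>c + k\<close> digits \<open>n\<close> times and watching for an overflow.
\<close>

section \<open>Large locally minimal alliances\<close>

definition near :: "'a set set \<Rightarrow> 'a \<Rightarrow> 'a \<Rightarrow> bool" where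
  "near E u v \<longleftrightarrow> u = v \<or> {u, v} \<in> E"

text \<open>Since \<open>near\<close> permits standing still, four \<open>near\<close> steps express
  distance at most 4 without a notion of walk.\<close>

definition within4 :: "'a set set \<Rightarrow> 'a \<Rightarrow> 'a \<Rightarrow> bool" where
  "within4 E u v \<longleftrightarrow> (\<exists>a b c. near E u a \<and> near E a b \<and> near E b c \<and> near E c v)"

lemma near_refl [simp]: "near E v v"
  by (simp add: near_def)

lemma near_sym: "near E u v \<Longrightarrow> near E v u"
  by (auto simp: near_def insert_commute)

lemma within4_sym: "within4 E u v \<Longrightarrow> within4 E v u"
  unfolding within4_def by (blast intro: near_sym)

lemma within4_refl [simp]: "within4 E v v"
  unfolding within4_def by (blast intro: near_refl)

text \<open>Greedy choice: picking \<open>v\<close> discards at most \<open>b\<close> elements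
  related to it, which leaves enough for the remaining picks.\<close>

lemma obtain_scattered_subset:
  fixes r :: "'a \<Rightarrow> 'a \<Rightarrow> bool"
  assumes "finite V" "0 < b" "k * b \<le> card V"
    and small: "\<And>v. v \<in> V \<Longrightarrow> card {u \<in> V. r v u} \<le> b"
    and refl: "\<And>v. r v v" and sym: "\<And>u v. r u v \<Longrightarrow> r v u"
  obtains S where "S \<subseteq> V" "card S = k" "pairwise (\<lambda>u v. \<not> r u v) S"
proof -
  have "\<exists>S\<subseteq>W. card S = k \<and> pairwise (\<lambda>u v. \<not> r u v) S" if "W \<subseteq> V" "k * b \<le> card W" for W
    using that
  proof (induction k arbitrary: W)
    case 0
    show ?case by (intro exI[of _ "{}"]) auto
  next
    case (Suc k)
    have finW: "finite W" using Suc.prems(1) \<open>finite V\<close> by (rule finite_subset)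
    have "card W > 0" using Suc.prems(2) \<open>0 < b\<close> by (simp add: less_le_trans)
    then obtain v where v: "v \<in> W" by (auto simp: card_gt_0_iff)
    define W' where "W' = W - {u \<in> V. r v u}"
    have "card W - b \<le> card W - card {u \<in> V. r v u}"
      using small[of v] v Suc.prems(1) by (intro diff_le_mono2) auto
    also have "\<dots> \<le> card W'"
      unfolding W'_def using \<open>finite V\<close> by (intro diff_card_le_card_Diff) auto
    finally have "k * b \<le> card W'" using Suc.prems(2) by simp
    then obtain S where S: "S \<subseteq> W'" "card S = k" "pairwise (\<lambda>u v. \<not> r u v) S"
      using Suc.IH[of W'] Suc.prems(1) by (auto simp: W'_def)
    have far: "\<not> r v s" if "s \<in> S" for s
      using that S(1) Suc.prems(1) by (auto simp: W'_def)
    then have "v \<notin> S" using refl by blast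
    moreover have "finite S" using S(1) finW by (auto simp: W'_def intro: finite_subset)
    ultimately have "card (insert v S) = Suc k" using S(2) by simp
    moreover have "pairwise (\<lambda>u v. \<not> r u v) (insert v S)"
      using S(3) far sym by (auto simp: pairwise_insert)
    moreover have "insert v S \<subseteq> W" using v S(1) by (auto simp: W'_def)
    ultimately show ?case by blast
  qed
  then show ?thesis using that assms(3) by blast
qed

section \<open>Degrees and removable vertices of alliances\<close>

locale tf_graph =
  fixes V :: "'a set" and E :: "'a set set"
  assumes graph: "simple_graph V E"
    and triangle_free: "triangle_free E"
    and min_deg: "min_degree_at_least 2 V E"
begin

lemma finite_V: "finite V"
  using graph by (simp add: simple_graph_def)

lemma edge: "{u, v} \<in> E \<Longrightarrow> u \<in> V \<and> v \<in> V \<and> u \<noteq> v"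
  using graph by (fastforce simp: simple_graph_def)

lemma no_triangle: "{u, v} \<in> E \<Longrightarrow> {v, w} \<in> E \<Longrightarrow> {u, w} \<notin> E"
  using triangle_free unfolding triangle_free_def by blast

abbreviation deg :: "'a \<Rightarrow> nat" where
  "deg \<equiv> deg_in E V"

lemma deg_ge_2: "v \<in> V \<Longrightarrow> 2 \<le> deg v"
  using min_deg by (simp add: min_degree_at_least_def)

lemma deg_in_mono: "A \<subseteq> B \<Longrightarrow> B \<subseteq> V \<Longrightarrow> deg_in E A v \<le> deg_in E B v"
  unfolding deg_in_def using finite_V by (intro card_mono) (auto intro: finite_subset)

lemma deg_in_le_card: "A \<subseteq> V \<Longrightarrow> deg_in E A v \<le> card A"
  unfolding deg_in_def using finite_V by (intro card_mono) (auto intro: finite_subset)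

lemma deg_in_compl: "D \<subseteq> V \<Longrightarrow> deg_in E D v + deg_in E (V - D) v = deg v"
  unfolding deg_in_def using finite_V
  by (subst card_Un_disjoint[symmetric]) (auto intro: finite_subset arg_cong[of _ _ card])

lemma deg_in_remove:
  assumes "D \<subseteq> V" "u \<in> D"
  shows "deg_in E D w = deg_in E (D - {u}) w + (if {u, w} \<in> E then 1 else 0)"
proof -
  have "{x \<in> D. {x, w} \<in> E} =
    {x \<in> D - {u}. {x, w} \<in> E} \<union> (if {u, w} \<in> E then {u} else {})"
    using assms by auto
  moreover have "finite {x \<in> D - {u}. {x, w} \<in> E}"
    using finite_V assms by (auto intro: finite_subset)
  ultimately show ?thesis unfolding deg_in_def by simp
qed

text \<open>The degrees into \<open>D\<close> and into its complement add up to
  \<open>deg v\<close>, so the condition involves a single varying quantity.\<close>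

lemma alliance_iff:
  "defensive_alliance V E D \<longleftrightarrow> D \<noteq> {} \<and> D \<subseteq> V \<and> (\<forall>v\<in>D. deg v \<le> 2 * deg_in E D v + 1)"
proof (cases "D \<subseteq> V")
  case True
  then have "(deg_in E (V - D) v \<le> deg_in E D v + 1) = (deg v \<le> 2 * deg_in E D v + 1)" for v
    using deg_in_compl[of D v] by linarith
  then show ?thesis by (simp add: defensive_alliance_def)
qed (simp add: defensive_alliance_def)

lemma alliance_deg_ge_1:
  assumes "defensive_alliance V E D" "v \<in> D"
  shows "1 \<le> deg_in E D v"
  using assms deg_ge_2[of v] by (force simp: alliance_iff)

text \<open>Removing a neighbour of a vertex lowers its degree into the alliance by one, so these are
  the vertices whose neighbours cannot be removed.\<close>

definition marginal :: "'a set \<Rightarrow> 'a \<Rightarrow> bool" where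
  "marginal D w \<longleftrightarrow> w \<in> D \<and> 2 * deg_in E D w \<le> deg w"

text \<open>Deleting \<open>u\<close> costs each neighbour \<open>w\<close> exactly one, and
  \<open>deg w \<le> 2 * (deg_in E D w - 1) + 1\<close> fails just for marginal \<open>w\<close>.
  The rest of \<open>D\<close> is nonempty because minimum degree 2 forces a neighbour of
  \<open>u\<close> into \<open>D\<close>.\<close>

lemma alliance_remove_iff:
  assumes D: "defensive_alliance V E D" and u: "u \<in> D"
  shows "defensive_alliance V E (D - {u}) \<longleftrightarrow> (\<forall>w. marginal D w \<longrightarrow> {u, w} \<notin> E)"
proof
  have DV: "D \<subseteq> V" using D by (simp add: alliance_iff)
  note rem = deg_in_remove[OF DV u]
  {
    assume A: "defensive_alliance V E (D - {u})"
    show "\<forall>w. marginal D w \<longrightarrow> {u, w} \<notin> E"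
    proof (intro allI impI notI)
      fix w assume w: "marginal D w" "{u, w} \<in> E"
      then have "w \<in> D - {u}" using edge by (auto simp: marginal_def)
      then have "deg w \<le> 2 * deg_in E (D - {u}) w + 1" using A by (simp add: alliance_iff)
      with w rem[of w] show False by (simp add: marginal_def)
    qed
  next
    assume N: "\<forall>w. marginal D w \<longrightarrow> {u, w} \<notin> E"
    have "\<exists>x\<in>D. {x, u} \<in> E"
      using alliance_deg_ge_1[OF D u] by (auto simp: deg_in_def card_gt_0_iff Suc_le_eq)
    then have "D - {u} \<noteq> {}" using edge by blast
    moreover have "deg w \<le> 2 * deg_in E (D - {u}) w + 1" if w: "w \<in> D - {u}" for w
    proof (cases "{u, w} \<in> E")
      case True
      with N w have "2 * deg_in E D w > deg w" by (force simp: marginal_def)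
      with rem[of w] True show ?thesis by simp
    next
      case False
      with rem[of w] D w show ?thesis by (auto simp: alliance_iff)
    qed
    ultimately show "defensive_alliance V E (D - {u})"
      using DV by (auto simp: alliance_iff)
  }
qed

text \<open>Take a smallest alliance between \<open>C\<close> and \<open>D\<close>. Vertices outside
  \<open>C\<close> are kept by minimality. A vertex of \<open>C\<close> has a marginal neighbour in
  \<open>C\<close>, which stays marginal because degrees into the shrinking alliance only
  drop.\<close>

lemma locally_minimal_superset:
  assumes D: "defensive_alliance V E D" and C: "C \<subseteq> D"
    and dom: "\<And>u. u \<in> C \<Longrightarrow> \<exists>w\<in>C. marginal D w \<and> {u, w} \<in> E"
  obtains D' where "locally_minimal_defensive_alliance V E D'" "C \<subseteq> D'"
proof -
  let ?P = "\<lambda>X. defensive_alliance V E X \<and> C \<subseteq> X \<and> X \<subseteq> D"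
  obtain D' where D': "?P D'" and min: "\<And>X. ?P X \<Longrightarrow> card D' \<le> card X"
    using ex_has_least_nat[of ?P D card] D C by blast
  have DV: "D \<subseteq> V" using D by (simp add: alliance_iff)
  have finD': "finite D'" using D' DV finite_V by (meson finite_subset)
  have "\<not> defensive_alliance V E (D' - {u})" if u: "u \<in> D'" for u
  proof
    assume A: "defensive_alliance V E (D' - {u})"
    show False
    proof (cases "u \<in> C")
      case True
      then obtain w where w: "w \<in> C" "marginal D w" "{u, w} \<in> E" using dom by blast
      have "deg_in E D' w \<le> deg_in E D w" using D' DV by (intro deg_in_mono) auto
      then have "marginal D' w" using w D' by (auto simp: marginal_def)
      then show False using A alliance_remove_iff D' u w(3) by blast
    next
      case False
      then have "card D' \<le> card (D' - {u})" using A D' by (intro min) auto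
      then show False using u finD' card_Diff1_less[of D' u] by linarith
    qed
  qed
  then have "locally_minimal_defensive_alliance V E D'"
    using D' by (simp add: locally_minimal_defensive_alliance_def)
  then show ?thesis using that D' by blast
qed

text \<open>The bound on \<open>card A\<close> serves two uses: \<open>A\<close> is nonempty for
  every \<open>v\<close>, and it is large when \<open>deg v\<close> is large.\<close>

lemma locally_minimal_near_scattered_set:
  assumes "V \<noteq> {}" "S \<subseteq> V" and scattered: "pairwise (\<lambda>u v. \<not> within4 E u v) S"
  obtains D' where "locally_minimal_defensive_alliance V E D'"
    "\<And>v. v \<in> S \<Longrightarrow> v \<in> D' \<or> (\<exists>A. (\<forall>u\<in>A. {u, v} \<in> E \<and> (\<exists>x\<in>D'. {x, u} \<in> E)) \<and>
        deg v \<le> 2 * card A + 1)"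
proof -
  let ?P = "\<lambda>X. defensive_alliance V E X \<and> S \<subseteq> X"
  have "?P V" using assms by (simp add: alliance_iff)
  then obtain D where D: "?P D" and min: "\<And>X. ?P X \<Longrightarrow> card D \<le> card X"
    using ex_has_least_nat[of ?P V card] by blast
  have DV: "D \<subseteq> V" using D by (simp add: alliance_iff)
  have finD: "finite D" using DV finite_V by (meson finite_subset)
  define R where "R = {v \<in> S. \<forall>w. marginal D w \<longrightarrow> {v, w} \<notin> E}"
  define C where "C = {u \<in> D. \<forall>v\<in>R. \<not> near E v u}"
  have dom: "\<exists>w\<in>C. marginal D w \<and> {u, w} \<in> E" if u: "u \<in> C" for u
  proof -
    have "\<exists>w. marginal D w \<and> {u, w} \<in> E"
    proof (cases "u \<in> S")
      case True
      moreover have "u \<notin> R" using u by (auto simp: C_def)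
      ultimately show ?thesis by (auto simp: R_def)
    next
      case False
      have "u \<in> D" using u by (simp add: C_def)
      \<comment> \<open>As \<open>u\<close> lies outside \<open>S\<close>, its removal would give a
        smaller alliance containing \<open>S\<close>.\<close>
      have "\<not> defensive_alliance V E (D - {u})"
      proof
        assume "defensive_alliance V E (D - {u})"
        then have "card D \<le> card (D - {u})" using D False by (intro min) auto
        then show False using \<open>u \<in> D\<close> finD card_Diff1_less[of D u] by linarith
      qed
      then show ?thesis using alliance_remove_iff D \<open>u \<in> D\<close> by blast
    qed
    then obtain w where w: "marginal D w" "{u, w} \<in> E" by blast
    \<comment> \<open>No vertex of \<open>R\<close> is adjacent to the marginal \<open>w\<close>;
      and \<open>w = v\<close> would put \<open>u\<close> next to \<open>v\<close>, against
      \<open>u \<in> C\<close>.\<close>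
    have "\<not> near E v w" if "v \<in> R" for v
      using that w u by (auto simp: C_def R_def near_def insert_commute)
    then have "w \<in> C" using w by (auto simp: C_def marginal_def)
    then show ?thesis using w by blast
  qed
  obtain D' where D': "locally_minimal_defensive_alliance V E D'" "C \<subseteq> D'"
    using locally_minimal_superset[of D C] D dom by (auto simp: C_def)
  have far: "v = w" if "v \<in> S" "w \<in> S" "within4 E v w" for v w
    using scattered that by (auto simp: pairwise_def)
  show ?thesis
  proof (rule that[OF D'(1)])
    fix v assume v: "v \<in> S"
    show "v \<in> D' \<or> (\<exists>A. (\<forall>u\<in>A. {u, v} \<in> E \<and> (\<exists>x\<in>D'. {x, u} \<in> E)) \<and>
        deg v \<le> 2 * card A + 1)"
    proof (cases "v \<in> R")
      case False
      have "\<not> near E r v" if "r \<in> R" for r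
      proof
        assume "near E r v"
        then have "within4 E r v" unfolding within4_def by (blast intro: near_refl)
        then have "r = v" using far v that by (auto simp: R_def)
        then show False using False that by blast
      qed
      then have "v \<in> C" using v D by (auto simp: C_def)
      then show ?thesis using D'(2) by blast
    next
      case True
      define A where "A = {u \<in> D. {u, v} \<in> E}"
      have "deg v \<le> 2 * card A + 1" using D v by (auto simp: alliance_iff A_def deg_in_def)
      moreover have "\<exists>x\<in>D'. {x, u} \<in> E" if u: "u \<in> A" for u
      proof -
        \<comment> \<open>Not being marginal means more than \<open>deg u / 2 \<ge> 1\<close>
          neighbours in \<open>D\<close>, hence one besides \<open>v\<close>.\<close>
        have "\<not> marginal D u" using True u by (auto simp: R_def A_def insert_commute)
        then have "2 * deg_in E D u > deg u" using u by (auto simp: marginal_def A_def)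
        moreover have "deg u \<ge> 2" using u DV by (intro deg_ge_2) (auto simp: A_def)
        ultimately have "card {x \<in> D. {x, u} \<in> E} \<ge> 2" by (simp add: deg_in_def)
        then have "\<not> {x \<in> D. {x, u} \<in> E} \<subseteq> {v}"
          using card_mono[of "{v}" "{x \<in> D. {x, u} \<in> E}"] by auto
        then obtain x where x: "x \<in> D" "{x, u} \<in> E" "x \<noteq> v" by blast
        have nvu: "near E v u" using u by (auto simp: A_def near_def insert_commute)
        have nux: "near E u x" using x by (auto simp: near_def insert_commute)
        \<comment> \<open>Such an \<open>r\<close> has distance at most 3 from \<open>v\<close>, so
          \<open>r = v\<close>; then \<open>v\<close>, \<open>u\<close>, \<open>x\<close> form a
          triangle.\<close>
        have "\<not> near E r x" if "r \<in> R" for r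
        proof
          assume rx: "near E r x"
          then have "within4 E v r" using nvu nux
            unfolding within4_def by (blast intro: near_refl near_sym)
          then have "r = v" using far v that by (auto simp: R_def)
          then have "{v, x} \<in> E" using rx x(3) by (auto simp: near_def)
          then show False using no_triangle[of v u x] u x(2) by (auto simp: A_def insert_commute)
        qed
        then have "x \<in> C" using x(1) by (auto simp: C_def)
        then show ?thesis using x(2) D'(2) by blast
      qed
      ultimately show ?thesis by (intro disjI2 exI[of _ A]) (auto simp: A_def)
    qed
  qed
qed

section \<open>Balls in graphs of bounded degree\<close>

lemma card_near_image:
  assumes deg: "\<And>v. v \<in> V \<Longrightarrow> deg v \<le> d" and "X \<subseteq> V"
  shows "{y. \<exists>x\<in>X. near E x y} \<subseteq> V" "card {y. \<exists>x\<in>X. near E x y} \<le> card X * (d + 1)"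
proof -
  show "{y. \<exists>x\<in>X. near E x y} \<subseteq> V" using \<open>X \<subseteq> V\<close> edge by (auto simp: near_def)
  have finX: "finite X" using \<open>X \<subseteq> V\<close> finite_V by (rule finite_subset)
  have "card {y. near E x y} \<le> d + 1" if "x \<in> X" for x
  proof -
    have "{y. near E x y} = insert x {u \<in> V. {u, x} \<in> E}"
      using edge by (auto simp: near_def insert_commute)
    then have "card {y. near E x y} \<le> Suc (card {u \<in> V. {u, x} \<in> E})"
      by (simp add: card_insert_le_m1 card_insert_if finite_V)
    also have "\<dots> \<le> d + 1" using deg[of x] that \<open>X \<subseteq> V\<close> by (auto simp: deg_in_def)
    finally show ?thesis .
  qed
  then have "(\<Sum>x\<in>X. card {y. near E x y}) \<le> card X * (d + 1)"
    using sum_bounded_above[of X "\<lambda>x. card {y. near E x y}" "d + 1"] by simp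
  moreover have "card (\<Union>x\<in>X. {y. near E x y}) \<le> (\<Sum>x\<in>X. card {y. near E x y})"
    using finX by (rule card_UN_le)
  moreover have "(\<Union>x\<in>X. {y. near E x y}) = {y. \<exists>x\<in>X. near E x y}" by blast
  ultimately show "card {y. \<exists>x\<in>X. near E x y} \<le> card X * (d + 1)" by simp
qed

text \<open>The ball arises from \<open>{v}\<close> by four closed-neighbourhood steps, each
  multiplying the size by at most \<open>d + 1\<close>.\<close>

lemma card_within4:
  assumes deg: "\<And>v. v \<in> V \<Longrightarrow> deg v \<le> d" and "v \<in> V"
  shows "card {u \<in> V. within4 E v u} \<le> (d + 1) ^ 4"
proof -
  define N where "N X = {y. \<exists>x\<in>X. near E x y}" for X
  have N: "N X \<subseteq> V \<and> card (N X) \<le> m * (d + 1)" if "X \<subseteq> V \<and> card X \<le> m" for X m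
    using card_near_image[of d X, OF deg] that unfolding N_def
    by (meson mult_le_mono1 order_trans)
  have "{v} \<subseteq> V \<and> card {v} \<le> 1" using \<open>v \<in> V\<close> by simp
  from N[OF N[OF N[OF N[OF this]]]]
  have *: "N (N (N (N {v}))) \<subseteq> V \<and> card (N (N (N (N {v})))) \<le> (d + 1) ^ 4"
    by (simp only: power4_eq_xxxx mult_1)
  moreover have "{u \<in> V. within4 E v u} \<subseteq> N (N (N (N {v})))"
    unfolding N_def within4_def by auto
  ultimately show ?thesis
    using card_mono[of "N (N (N (N {v})))" "{u \<in> V. within4 E v u}"] finite_V
    by (meson finite_subset order_trans)
qed

theorem large_locally_minimal_alliance:
  assumes "V \<noteq> {}" and large: "k * (4 * k\<^sup>2 + 2) ^ 4 \<le> card V"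
  shows "\<exists>D. locally_minimal_defensive_alliance V E D \<and> k \<le> card D"
proof (cases "\<exists>v\<in>V. 4 * k\<^sup>2 + 2 \<le> deg v")
  case True
  then obtain v where v: "v \<in> V" "4 * k\<^sup>2 + 2 \<le> deg v" by blast
  then obtain D where D: "locally_minimal_defensive_alliance V E D"
    and alt: "v \<in> D \<or> (\<exists>A. (\<forall>u\<in>A. {u, v} \<in> E \<and> (\<exists>x\<in>D. {x, u} \<in> E)) \<and>
        deg v \<le> 2 * card A + 1)"
    using locally_minimal_near_scattered_set[OF \<open>V \<noteq> {}\<close>, of "{v}"] by auto
  have DA: "defensive_alliance V E D"
    using D by (simp add: locally_minimal_defensive_alliance_def)
  then have DV: "D \<subseteq> V" by (simp add: alliance_iff)
  have "k \<le> card D"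
  proof (rule ccontr)
    assume "\<not> k \<le> card D"
    then have small: "card D < k" by simp
    have deg_D: "deg x \<le> 2 * k" if "x \<in> D" for x
    proof -
      have "deg x \<le> 2 * deg_in E D x + 1" using DA that by (simp add: alliance_iff)
      with deg_in_le_card[OF DV, of x] small show ?thesis by linarith
    qed
    have "k \<le> k\<^sup>2" by (simp add: power2_eq_square)
    then have "v \<notin> D" using deg_D[of v] v(2) by linarith
    then obtain A where A: "\<forall>u\<in>A. {u, v} \<in> E \<and> (\<exists>x\<in>D. {x, u} \<in> E)"
      "deg v \<le> 2 * card A + 1" using alt by blast
    have finD: "finite D" using DV finite_V by (rule finite_subset)
    \<comment> \<open>Fewer than \<open>k\<close> vertices, each of degree at most
      \<open>2 * k\<close>, have all of \<open>A\<close> among their neighbours. So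
      \<open>card A\<close> is at most \<open>2 * k^2\<close> and \<open>deg v\<close> at most
      \<open>4 * k^2 + 1\<close>, which explains the threshold.\<close>
    have "A \<subseteq> (\<Union>x\<in>D. {u \<in> V. {u, x} \<in> E})"
      using A(1) edge by (fastforce simp: insert_commute)
    then have "card A \<le> card (\<Union>x\<in>D. {u \<in> V. {u, x} \<in> E})"
      using finD finite_V by (intro card_mono) auto
    also have "\<dots> \<le> (\<Sum>x\<in>D. card {u \<in> V. {u, x} \<in> E})" using finD by (rule card_UN_le)
    also have "\<dots> \<le> card D * (2 * k)"
      using sum_bounded_above[of D "\<lambda>x. card {u \<in> V. {u, x} \<in> E}" "2 * k"] deg_D
      by (simp add: deg_in_def)
    also have "\<dots> \<le> k * (2 * k)" using small by (intro mult_right_mono) auto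
    finally have "card A \<le> 2 * k\<^sup>2" by (simp add: power2_eq_square)
    then show False using A(2) v(2) by linarith
  qed
  then show ?thesis using D by blast
next
  case False
  then have "deg v \<le> 4 * k\<^sup>2 + 1" if "v \<in> V" for v using that by force
  from card_within4[OF this]
  have ball: "card {u \<in> V. within4 E v u} \<le> (4 * k\<^sup>2 + 2) ^ 4" if "v \<in> V" for v using that by simp
  obtain S where S: "S \<subseteq> V" "card S = k" "pairwise (\<lambda>u v. \<not> within4 E u v) S"
    by (rule obtain_scattered_subset[OF finite_V _ large ball]) (auto intro: within4_sym)
  obtain D where D: "locally_minimal_defensive_alliance V E D"
    and alt: "\<And>v. v \<in> S \<Longrightarrow> v \<in> D \<or> (\<exists>A. (\<forall>u\<in>A. {u, v} \<in> E \<and> (\<exists>x\<in>D. {x, u} \<in> E)) \<and>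
        deg v \<le> 2 * card A + 1)"
    using locally_minimal_near_scattered_set[OF \<open>V \<noteq> {}\<close> S(1,3)] by blast
  \<comment> \<open>Each \<open>v \<in> S\<close> gets a vertex of \<open>D\<close> at distance at
    most 2. Sharing one would bring two members of \<open>S\<close> within distance 4, so the choice
    is injective.\<close>
  have "\<exists>x\<in>D. \<exists>u. near E v u \<and> near E u x" if v: "v \<in> S" for v
    using alt[OF v]
  proof
    assume "v \<in> D"
    then show ?thesis by (blast intro: near_refl)
  next
    assume "\<exists>A. (\<forall>u\<in>A. {u, v} \<in> E \<and> (\<exists>x\<in>D. {x, u} \<in> E)) \<and> deg v \<le> 2 * card A + 1"
    then obtain A where A: "\<forall>u\<in>A. {u, v} \<in> E \<and> (\<exists>x\<in>D. {x, u} \<in> E)"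
      "deg v \<le> 2 * card A + 1" by blast
    have "card A \<noteq> 0" using A(2) deg_ge_2[of v] v S(1) by fastforce
    then obtain u where "u \<in> A" by (metis card.empty ex_in_conv)
    then obtain x where "x \<in> D" "near E u v" "near E x u" using A(1) by (auto simp: near_def)
    then show ?thesis by (blast intro: near_sym)
  qed
  then obtain x where x: "\<And>v. v \<in> S \<Longrightarrow> x v \<in> D \<and> (\<exists>u. near E v u \<and> near E u (x v))"
    by metis
  have "inj_on x S"
  proof (rule inj_onI)
    fix v w assume vw: "v \<in> S" "w \<in> S" "x v = x w"
    obtain a b where "near E v a" "near E a (x v)" "near E w b" "near E b (x v)"
      using x[OF vw(1)] x[OF vw(2)] vw(3) by auto
    then have "within4 E v w" unfolding within4_def by (blast intro: near_sym)
    then show "v = w" using S(3) vw by (auto simp: pairwise_def)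
  qed
  moreover have "x ` S \<subseteq> D" using x by blast
  moreover have "finite D"
    using D finite_V unfolding locally_minimal_defensive_alliance_def alliance_iff
    by (blast intro: finite_subset)
  ultimately have "k \<le> card D" using card_inj_on_le S(2) by metis
  then show ?thesis using D by blast
qed

end

section \<open>A machine comparing two unary numbers exponentially\<close>

lemma word_on_tape_nth: "i < length w \<Longrightarrow> word_on_tape w (int i) = Some (w ! i)"
  by (simp add: word_on_tape_def)

lemma word_on_tape_end: "word_on_tape w (int (length w)) = None"
  by (simp add: word_on_tape_def)

lemma word_on_tape_neg: "word_on_tape w (- 1) = None"
  by (simp add: word_on_tape_def)

lemma word_on_tape_snoc:
  "(word_on_tape w)(int (length w) := Some b) = word_on_tape (w @ [b])"
  by (rule ext) (auto simp: word_on_tape_def nth_append)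

lemma word_on_tape_update:
  "(word_on_tape (u @ a # v))(int (length u) := Some b) = word_on_tape (u @ b # v)"
  by (rule ext) (auto simp: word_on_tape_def nth_append nth_Cons split: nat.splits)

text \<open>The time is only an upper bound, so that estimates can be added and relaxed.\<close>

definition reaches :: "tm \<Rightarrow> nat \<Rightarrow> config \<Rightarrow> config \<Rightarrow> bool" where
  "reaches M t c c' \<longleftrightarrow> (\<exists>s\<le>t. (tm_step M ^^ s) c = c')"

lemma reaches_refl: "reaches M t c c"
  unfolding reaches_def by (intro exI[of _ 0]) auto

lemma reaches_step: "tm_step M c = c' \<Longrightarrow> reaches M 1 c c'"
  unfolding reaches_def by (intro exI[of _ 1]) auto

lemma reaches_trans:
  assumes "reaches M s a b" "reaches M t b c"
  shows "reaches M (s + t) a c"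
proof -
  obtain i j where "i \<le> s" "(tm_step M ^^ i) a = b" "j \<le> t" "(tm_step M ^^ j) b = c"
    using assms by (auto simp: reaches_def)
  then have "(tm_step M ^^ (j + i)) a = c" "j + i \<le> s + t" by (auto simp: funpow_add)
  then show ?thesis unfolding reaches_def by blast
qed

lemma reaches_mono: "reaches M s a b \<Longrightarrow> s \<le> t \<Longrightarrow> reaches M t a b"
  unfolding reaches_def by (blast intro: order_trans)

lemma reaches_step_trans: "tm_step M a = b \<Longrightarrow> reaches M t b c \<Longrightarrow> reaches M (Suc t) a c"
  using reaches_trans[OF reaches_step] by fastforce

text \<open>A halted configuration is a fixed point of \<open>tm_step\<close>, so the run can idle
  until exactly \<open>t\<close> steps have passed.\<close>

lemma reaches_imp_outputs_within:
  assumes "reaches M t (tm_init M w) c" "fst c = states M" "snd (snd c ! 1) = word_on_tape v"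
  shows "tm_outputs_within M w t v"
proof -
  have halt: "(tm_step M ^^ s) c = c" for s
    by (induction s) (auto simp: tm_step_def assms(2))
  obtain s where "s \<le> t" "(tm_step M ^^ s) (tm_init M w) = c"
    using assms(1) by (auto simp: reaches_def)
  then have "(tm_step M ^^ ((t - s) + s)) (tm_init M w) = c"
    unfolding funpow_add by (simp add: halt)
  with \<open>s \<le> t\<close> assms show ?thesis by (simp add: tm_outputs_within_def)
qed

section \<open>Binary counters; \<open>None\<close> signals a carry past the last digit\<close>

fun bits_val :: "bool list \<Rightarrow> nat" where
  "bits_val [] = 0"
| "bits_val (b # bs) = of_bool b + 2 * bits_val bs"

fun bits_inc :: "bool list \<Rightarrow> bool list option" where
  "bits_inc [] = None"
| "bits_inc (False # bs) = Some (True # bs)"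
| "bits_inc (True # bs) = map_option (Cons False) (bits_inc bs)"

lemma bits_val_less: "bits_val bs < 2 ^ length bs"
  by (induction bs) auto

lemma bits_val_replicate_False: "bits_val (replicate n False) = 0"
  by (induction n) auto

lemma bits_inc_Some:
  "bits_inc bs = Some cs \<Longrightarrow> bits_val cs = Suc (bits_val bs) \<and> length cs = length bs"
  by (induction bs arbitrary: cs rule: bits_inc.induct) auto

lemma bits_inc_None: "bits_inc bs = None \<Longrightarrow> Suc (bits_val bs) = 2 ^ length bs"
  by (induction bs rule: bits_inc.induct) auto

text \<open>
  Below state \<open>c\<close> the machine writes \<open>c\<close> zeros on tape 2; state \<open>c\<close> appends a zero per symbol of
  \<open>1^k\<close>. This is the counter, least significant digit first. State \<open>c + 1\<close> moves its head back
  to the left end and advances the input head; state \<open>c + 2\<close> increments it for each symbol of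
  \<open>1^n\<close>. Without overflow, \<open>c + 3\<close> rewinds the input and \<open>c + 4\<close> copies it to the output tape; on
  overflow, the states from \<open>c + 5\<close> on write \<open>w\<close> there.
\<close>

definition threshold_tm :: "nat \<Rightarrow> bool list \<Rightarrow> tm" where
  "threshold_tm c w = \<lparr>tapes = 3, states = c + 5 + length w, delta = (\<lambda>q ss.
     let x = ss ! 0; y = ss ! 1; z = ss ! 2 in
     if q < c then (q + 1, [(x, Stay), (y, Stay), (Some False, Go_Right)])
     else if q = c then
       (if x = Some True then (c, [(x, Go_Right), (y, Stay), (Some False, Go_Right)])
        else (c + 1, [(x, Stay), (y, Stay), (z, Go_Left)]))
     else if q = c + 1 then
       (if z = None then (c + 2, [(x, Go_Right), (y, Stay), (z, Go_Right)])
        else (c + 1, [(x, Stay), (y, Stay), (z, Go_Left)]))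
     else if q = c + 2 then
       (if x = Some True then
          (case z of
             Some True \<Rightarrow> (c + 2, [(x, Stay), (y, Stay), (Some False, Go_Right)])
           | Some False \<Rightarrow> (c + 1, [(x, Stay), (y, Stay), (Some True, Go_Left)])
           | None \<Rightarrow> (c + 5, [(x, Stay), (y, Stay), (z, Stay)]))
        else (c + 3, [(x, Go_Left), (y, Stay), (z, Stay)]))
     else if q = c + 3 then
       (if x = None then (c + 4, [(x, Go_Right), (y, Stay), (z, Stay)])
        else (c + 3, [(x, Go_Left), (y, Stay), (z, Stay)]))
     else if q = c + 4 then
       (if x = None then (c + 5 + length w, [(x, Stay), (y, Stay), (z, Stay)])
        else (c + 4, [(x, Go_Right), (x, Go_Right), (z, Stay)]))
     else (q + 1, [(x, Stay), (Some (w ! (q - (c + 5))), Go_Right), (z, Stay)]))\<rparr>"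

lemma threshold_tm_wf: "tm_wf (threshold_tm c w)"
  unfolding tm_wf_def threshold_tm_def
  by (auto simp: Let_def split: option.splits bool.splits)

section \<open>The phases of a run\<close>

locale threshold_run =
  fixes c :: nat and w xs :: "bool list"
begin

abbreviation M :: tm where
  "M \<equiv> threshold_tm c w"

text \<open>The input tape is only ever rewritten with its own symbols, and the output head always
  stands just behind the output.\<close>

definition conf :: "nat \<Rightarrow> int \<Rightarrow> bool list \<Rightarrow> int \<Rightarrow> bool list \<Rightarrow> config" where
  "conf q i out j ds =
     (q, [(i, word_on_tape xs), (int (length out), word_on_tape out), (j, word_on_tape ds)])"

lemmas step_simps = conf_def tm_step_def threshold_tm_def tape_read_def tape_act_def Let_def
  fun_upd_idem word_on_tape_end

lemma step_prelude:
  "q < c \<Longrightarrow> tm_step M (conf q i out (int (length ds)) ds) =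
     conf (Suc q) i out (int (length (ds @ [False]))) (ds @ [False])"
  by (simp add: step_simps word_on_tape_snoc)

lemma run_prelude:
  "q \<le> c \<Longrightarrow> reaches M q (conf 0 i out 0 []) (conf q i out (int q) (replicate q False))"
proof (induction q)
  case 0
  show ?case by (simp add: reaches_refl)
next
  case (Suc q)
  have "reaches M 1 (conf q i out (int q) (replicate q False))
      (conf (Suc q) i out (int (Suc q)) (replicate (Suc q) False))"
    using step_prelude[of q i out "replicate q False"] Suc.prems
    by (intro reaches_step) (simp add: replicate_append_same)
  then show ?case using reaches_trans[of M q] Suc by fastforce
qed

lemma run_param:
  assumes "\<And>i. i < k \<Longrightarrow> i < length xs \<and> xs ! i"
  shows "reaches M k (conf c 0 out (int c) (replicate c False))
      (conf c (int k) out (int (c + k)) (replicate (c + k) False))"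
  using assms
proof (induction k)
  case 0
  show ?case by (simp add: reaches_refl)
next
  case (Suc k)
  have "word_on_tape xs (int k) = Some True" using Suc.prems[of k] by (simp add: word_on_tape_nth)
  then have "tm_step M (conf c (int k) out (int (c + k)) (replicate (c + k) False)) =
      conf c (int (Suc k)) out (int (c + Suc k)) (replicate (c + Suc k) False)"
    using word_on_tape_snoc[of "replicate (c + k) False" False]
    by (simp add: step_simps replicate_append_same add.commute)
  then have "reaches M 1 (conf c (int k) out (int (c + k)) (replicate (c + k) False))
      (conf c (int (Suc k)) out (int (c + Suc k)) (replicate (c + Suc k) False))"
    by (rule reaches_step)
  then show ?case using reaches_trans[of M k] Suc by fastforce
qed

text \<open>With the head at \<open>int l - 1\<close>, the case \<open>l = 0\<close> is the blank
  cell left of the counter. The last step also moves the input head to the next symbol to be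
  counted.\<close>

lemma run_rewind_counter:
  "l \<le> length ds \<Longrightarrow>
     reaches M (l + 1) (conf (c + 1) i out (int l - 1) ds) (conf (c + 2) (i + 1) out 0 ds)"
proof (induction l)
  case 0
  have "tm_step M (conf (c + 1) i out (int 0 - 1) ds) = conf (c + 2) (i + 1) out 0 ds"
    by (simp add: step_simps word_on_tape_neg)
  then show ?case using reaches_step by fastforce
next
  case (Suc l)
  then have "tm_step M (conf (c + 1) i out (int (Suc l) - 1) ds) =
      conf (c + 1) i out (int l - 1) ds"
    by (simp add: step_simps word_on_tape_nth)
  from reaches_step_trans[OF this] show ?case using Suc by simp
qed

text \<open>The prefix \<open>ps\<close> holds the digits the carry has already passed; it must vary
  in the induction.\<close>

lemma run_inc_Some:
  assumes "word_on_tape xs i = Some True" "bits_inc bs = Some cs"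
  shows "\<exists>l\<le>length (ps @ cs). reaches M (length bs)
      (conf (c + 2) i out (int (length ps)) (ps @ bs)) (conf (c + 1) i out (int l - 1) (ps @ cs))"
  using assms(2)
proof (induction bs arbitrary: ps cs rule: bits_inc.induct)
  case (2 bs)
  have "tm_step M (conf (c + 2) i out (int (length ps)) (ps @ False # bs)) =
      conf (c + 1) i out (int (length ps) - 1) (ps @ True # bs)"
    using assms(1) word_on_tape_nth[of "length ps" "ps @ False # bs"]
    by (simp add: step_simps word_on_tape_update)
  then have "reaches M 1 (conf (c + 2) i out (int (length ps)) (ps @ False # bs))
      (conf (c + 1) i out (int (length ps) - 1) (ps @ True # bs))"
    by (rule reaches_step)
  then show ?case using 2
    by (intro exI[of _ "length ps"]) (auto intro: reaches_mono)
next
  case (3 bs)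
  then obtain ds where ds: "bits_inc bs = Some ds" "cs = False # ds" by auto
  have "tm_step M (conf (c + 2) i out (int (length ps)) (ps @ True # bs)) =
      conf (c + 2) i out (int (length (ps @ [False]))) ((ps @ [False]) @ bs)"
    using assms(1) word_on_tape_nth[of "length ps" "ps @ True # bs"]
    by (simp add: step_simps word_on_tape_update)
  note step = reaches_step_trans[OF this]
  obtain l where "l \<le> length ((ps @ [False]) @ ds)" "reaches M (length bs)
      (conf (c + 2) i out (int (length (ps @ [False]))) ((ps @ [False]) @ bs))
      (conf (c + 1) i out (int l - 1) ((ps @ [False]) @ ds))"
    using "3.IH"[OF ds(1), of "ps @ [False]"] by blast
  then show ?case using step[of "length bs"] ds(2) by (intro exI[of _ l]) simp
qed simp

lemma run_inc_None:
  assumes "word_on_tape xs i = Some True" "bits_inc bs = None"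
  shows "\<exists>j ds. reaches M (length bs + 1)
      (conf (c + 2) i out (int (length ps)) (ps @ bs)) (conf (c + 5) i out j ds)"
  using assms(2)
proof (induction bs arbitrary: ps rule: bits_inc.induct)
  case 1
  have "tm_step M (conf (c + 2) i out (int (length ps)) (ps @ [])) =
      conf (c + 5) i out (int (length ps)) ps"
    using assms(1) by (simp add: step_simps)
  then show ?case using reaches_step[of M] by fastforce
next
  case (3 bs)
  have "tm_step M (conf (c + 2) i out (int (length ps)) (ps @ True # bs)) =
      conf (c + 2) i out (int (length (ps @ [False]))) ((ps @ [False]) @ bs)"
    using assms(1) word_on_tape_nth[of "length ps" "ps @ True # bs"]
    by (simp add: step_simps word_on_tape_update)
  note step = reaches_step_trans[OF this]
  obtain j ds where "reaches M (length bs + 1)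
      (conf (c + 2) i out (int (length (ps @ [False]))) ((ps @ [False]) @ bs))
      (conf (c + 5) i out j ds)"
    using "3.IH"[of "ps @ [False]"] 3 by auto
  from step[OF this] show ?case by auto
qed simp

text \<open>A symbol costs at most \<open>length ds\<close> steps for the increment and
  \<open>length ds + 1\<close> for the rewind. The value grows by one per symbol, so overflow occurs
  exactly when it would reach \<open>2 ^ length ds\<close>.\<close>

lemma run_count:
  assumes "\<And>i. i < n \<Longrightarrow> p + i < length xs \<and> xs ! (p + i)"
  shows "(bits_val ds + n < 2 ^ length ds \<longrightarrow>
      (\<exists>ds'. reaches M (n * (2 * length ds + 1))
        (conf (c + 2) (int p) out 0 ds) (conf (c + 2) (int (p + n)) out 0 ds'))) \<and>
    (2 ^ length ds \<le> bits_val ds + n \<longrightarrow>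
      (\<exists>i j ds'. reaches M (n * (2 * length ds + 1))
        (conf (c + 2) (int p) out 0 ds) (conf (c + 5) i out j ds')))"
  using assms
proof (induction n arbitrary: p ds)
  case 0
  have "\<not> 2 ^ length ds \<le> bits_val ds" using bits_val_less[of ds] by simp
  then show ?case by (auto intro: reaches_refl)
next
  case (Suc n)
  have x: "word_on_tape xs (int p) = Some True"
    using Suc.prems[of 0] by (simp add: word_on_tape_nth)
  show ?case
  proof (cases "bits_inc ds")
    case None
    then have "Suc (bits_val ds) = 2 ^ length ds" by (rule bits_inc_None)
    moreover obtain j ds' where
      "reaches M (length ds + 1) (conf (c + 2) (int p) out 0 ds) (conf (c + 5) (int p) out j ds')"
      using run_inc_None[OF x None, of out "[]"] by auto
    then have "reaches M (Suc n * (2 * length ds + 1)) (conf (c + 2) (int p) out 0 ds)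
        (conf (c + 5) (int p) out j ds')"
      by (rule reaches_mono) (simp add: algebra_simps)
    ultimately show ?thesis by auto
  next
    case (Some es)
    then have es: "bits_val es = Suc (bits_val ds)" "length es = length ds"
      using bits_inc_Some by auto
    obtain l where l: "l \<le> length es" and r1: "reaches M (length ds)
        (conf (c + 2) (int p) out 0 ds) (conf (c + 1) (int p) out (int l - 1) es)"
      using run_inc_Some[OF x Some, of "[]" out] by auto
    have "reaches M (length ds + (l + 1)) (conf (c + 2) (int p) out 0 ds)
        (conf (c + 2) (int (Suc p)) out 0 es)"
      using reaches_trans[OF r1 run_rewind_counter[OF l]] by (simp add: add.commute)
    then have r: "reaches M (2 * length ds + 1) (conf (c + 2) (int p) out 0 ds)
        (conf (c + 2) (int (Suc p)) out 0 es)"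
      by (rule reaches_mono) (use l es in simp)
    have IH: "(bits_val ds + Suc n < 2 ^ length ds \<longrightarrow>
      (\<exists>ds'. reaches M (n * (2 * length ds + 1))
        (conf (c + 2) (int (Suc p)) out 0 es) (conf (c + 2) (int (p + Suc n)) out 0 ds'))) \<and>
      (2 ^ length ds \<le> bits_val ds + Suc n \<longrightarrow>
      (\<exists>i j ds'. reaches M (n * (2 * length ds + 1))
        (conf (c + 2) (int (Suc p)) out 0 es) (conf (c + 5) i out j ds')))"
      using Suc.IH[of "Suc p" es] Suc.prems[of "Suc _"] es by (simp add: add.commute)
    show ?thesis
      unfolding mult_Suc using IH reaches_trans[OF r] by meson
  qed
qed

lemma run_rewind_input:
  "l \<le> length xs \<Longrightarrow>
     reaches M (l + 1) (conf (c + 3) (int l - 1) out j ds) (conf (c + 4) 0 out j ds)"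
proof (induction l)
  case 0
  have "tm_step M (conf (c + 3) (int 0 - 1) out j ds) = conf (c + 4) 0 out j ds"
    by (simp add: step_simps word_on_tape_neg)
  then show ?case using reaches_step by fastforce
next
  case (Suc l)
  then have "tm_step M (conf (c + 3) (int (Suc l) - 1) out j ds) =
      conf (c + 3) (int l - 1) out j ds"
    by (simp add: step_simps word_on_tape_nth)
  from reaches_step_trans[OF this] show ?case using Suc by simp
qed

lemma run_copy:
  "l \<le> length xs \<Longrightarrow> reaches M l (conf (c + 4) 0 [] j ds) (conf (c + 4) (int l) (take l xs) j ds)"
proof (induction l)
  case 0
  show ?case by (simp add: reaches_refl)
next
  case (Suc l)
  then have "tm_step M (conf (c + 4) (int l) (take l xs) j ds) =
      conf (c + 4) (int (Suc l)) (take (Suc l) xs) j ds"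
    using word_on_tape_snoc[of "take l xs" "xs ! l"]
    by (simp add: step_simps word_on_tape_nth take_Suc_conv_app_nth add.commute)
  then have "reaches M 1 (conf (c + 4) (int l) (take l xs) j ds)
      (conf (c + 4) (int (Suc l)) (take (Suc l) xs) j ds)"
    by (rule reaches_step)
  then show ?case using reaches_trans[of M l] Suc by fastforce
qed

lemma run_copy_halt:
  "reaches M (length xs + 1) (conf (c + 4) 0 [] j ds)
     (conf (states M) (int (length xs)) xs j ds)"
proof -
  have "reaches M (length xs) (conf (c + 4) 0 [] j ds) (conf (c + 4) (int (length xs)) xs j ds)"
    using run_copy[of "length xs"] by simp
  moreover have "tm_step M (conf (c + 4) (int (length xs)) xs j ds) =
      conf (states M) (int (length xs)) xs j ds"
    by (simp add: step_simps)
  ultimately show ?thesis by (blast intro: reaches_trans reaches_step)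
qed

text \<open>The word \<open>w\<close> is hard-wired: state \<open>c + 5 + l\<close> has
  \<open>l\<close> symbols written, and \<open>l = length w\<close> is the halting state.\<close>

lemma run_write:
  "l \<le> length w \<Longrightarrow> reaches M l (conf (c + 5) i [] j ds) (conf (c + 5 + l) i (take l w) j ds)"
proof (induction l)
  case 0
  show ?case by (simp add: reaches_refl)
next
  case (Suc l)
  then have "tm_step M (conf (c + 5 + l) i (take l w) j ds) =
      conf (c + 5 + Suc l) i (take (Suc l) w) j ds"
    using word_on_tape_snoc[of "take l w" "w ! l"]
    by (simp add: step_simps take_Suc_conv_app_nth add.commute)
  then have "reaches M 1 (conf (c + 5 + l) i (take l w) j ds)
      (conf (c + 5 + Suc l) i (take (Suc l) w) j ds)"
    by (rule reaches_step)
  then show ?case using reaches_trans[of M l] Suc by fastforce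
qed

text \<open>The time bound may depend on the input only through its length, so \<open>k\<close> and
  \<open>n\<close> are estimated by \<open>length xs\<close>.\<close>

lemma run_threshold:
  assumes xs: "xs = replicate k True @ [False] @ replicate n True @ [False] @ ys"
  shows "tm_outputs_within M xs
      (3 * c + 10 + length w + length xs * (2 * c + 2 * length xs + 5))
      (if 2 ^ (c + k) \<le> n then w else xs)"
proof -
  let ?ds = "replicate (c + k) False"
  have len: "k + n + 2 \<le> length xs" using xs by simp
  have init: "tm_init M xs = conf 0 0 [] 0 []"
    by (simp add: tm_init_def conf_def threshold_tm_def numeral_2_eq_2)
  have x1: "i < length xs \<and> xs ! i" if "i < k" for i
    using that xs by (simp add: nth_append)
  have x2: "Suc k + i < length xs \<and> xs ! (Suc k + i)" if "i < n" for i
    using that xs by (simp add: nth_append nth_Cons)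
  have x3: "word_on_tape xs (int k) = Some False"
    using word_on_tape_nth[of k xs] xs len by (simp add: nth_append)
  have x4: "word_on_tape xs (int (Suc k + n)) = Some False"
    using word_on_tape_nth[of "Suc k + n" xs] xs len by (simp add: nth_append nth_Cons)
  have r1: "reaches M (c + k) (tm_init M xs) (conf c (int k) [] (int (c + k)) ?ds)"
    unfolding init by (rule reaches_trans[OF run_prelude[OF order_refl] run_param[OF x1]])
  have "tm_step M (conf c (int k) [] (int (c + k)) ?ds) =
      conf (c + 1) (int k) [] (int (c + k) - 1) ?ds"
    using x3 by (simp add: step_simps)
  note r2 = reaches_trans[OF r1 reaches_step[OF this]]
  have r3: "reaches M (c + k + 1 + (c + k + 1)) (tm_init M xs) (conf (c + 2) (int (Suc k)) [] 0 ?ds)"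
    using reaches_trans[OF r2 run_rewind_counter] by (simp add: add.commute)
  note count = run_count[OF x2, where ds = ?ds and out = "[]",
      unfolded bits_val_replicate_False length_replicate add_0]
  have "k * (2 * c + 2 * length xs + 1) + n * (2 * (c + k) + 1)
      \<le> k * (2 * c + 2 * length xs + 1) + n * (2 * c + 2 * length xs + 1)"
    using len by (intro add_left_mono mult_left_mono) auto
  also have "\<dots> = (k + n) * (2 * c + 2 * length xs + 1)" by (simp add: algebra_simps)
  also have "\<dots> \<le> length xs * (2 * c + 2 * length xs + 1)"
    using len by (intro mult_right_mono) auto
  finally have time: "n * (2 * (c + k) + 1) \<le> length xs * (2 * c + 2 * length xs + 1)"
    by linarith
  show ?thesis
  proof (cases "2 ^ (c + k) \<le> n")
    case True
    then obtain i j ds where "reaches M (n * (2 * (c + k) + 1))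
        (conf (c + 2) (int (Suc k)) [] 0 ?ds) (conf (c + 5) i [] j ds)"
      using count by blast
    note r4 = reaches_trans[OF reaches_trans[OF r3 this] run_write[OF order_refl]]
    show ?thesis
      by (rule reaches_imp_outputs_within[OF reaches_mono[OF r4]])
        (use True time len in \<open>simp_all add: conf_def threshold_tm_def algebra_simps\<close>)
  next
    case False
    then obtain ds where r4: "reaches M (n * (2 * (c + k) + 1))
        (conf (c + 2) (int (Suc k)) [] 0 ?ds) (conf (c + 2) (int (Suc k + n)) [] 0 ds)"
      using count by force
    have "tm_step M (conf (c + 2) (int (Suc k + n)) [] 0 ds) =
        conf (c + 3) (int (Suc k + n) - 1) [] 0 ds"
      using x4 by (simp add: step_simps)
    note r5 = reaches_trans[OF reaches_trans[OF r3 r4] reaches_step[OF this]]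
    have "Suc k + n \<le> length xs" using len by simp
    note r6 = reaches_trans[OF reaches_trans[OF r5 run_rewind_input[OF this]] run_copy_halt]
    show ?thesis
      by (rule reaches_imp_outputs_within[OF reaches_mono[OF r6]])
        (use False time len in \<open>simp_all add: conf_def algebra_simps\<close>)
  qed
qed

end

lemma threshold_poly_time:
  assumes "\<And>x. x \<in> X \<Longrightarrow> \<exists>ys. enc x = replicate (k x) True @ [False] @ replicate (n x) True @ [False] @ ys"
  shows "poly_time_computable_on X enc enc (\<lambda>x. if 2 ^ (c + k x) \<le> n x then x0 else x)"
proof -
  let ?w = "enc x0"
  let ?p = "[:3 * c + 10 + length ?w, 2 * c + 5, 2:] :: nat poly"
  have "tm_outputs_within (threshold_tm c ?w) (enc x) (poly ?p (length (enc x)))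
      (enc (if 2 ^ (c + k x) \<le> n x then x0 else x))" if "x \<in> X" for x
  proof -
    obtain ys where ys: "enc x = replicate (k x) True @ [False] @ replicate (n x) True @ [False] @ ys"
      using assms \<open>x \<in> X\<close> by blast
    have "poly ?p (length (enc x)) =
        3 * c + 10 + length ?w + length (enc x) * (2 * c + 2 * length (enc x) + 5)"
      by (simp add: algebra_simps)
    then show ?thesis
      using threshold_run.run_threshold[OF ys, of c ?w] by (simp only: if_distrib[of enc])
  qed
  then show ?thesis unfolding poly_time_computable_on_def using threshold_tm_wf by blast
qed

section \<open>The kernel\<close>

definition C4 :: "nat set set" where
  "C4 = {{0, 1}, {1, 2}, {2, 3}, {3, 0}}"

lemma C4_deg_in:
  "deg_in C4 {0..<4} 0 = 2" "deg_in C4 {0..<4} 1 = 2"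
  "deg_in C4 {0..<4} 2 = 2" "deg_in C4 {0..<4} 3 = 2"
proof -
  have V: "{0..<4} = {0, 1, 2, 3 :: nat}" by auto
  have "{u \<in> {0, 1, 2, 3}. {u, 0} \<in> C4} = {1, 3}" "{u \<in> {0, 1, 2, 3}. {u, 1} \<in> C4} = {0, 2}"
    "{u \<in> {0, 1, 2, 3}. {u, 2} \<in> C4} = {1, 3}" "{u \<in> {0, 1, 2, 3}. {u, 3} \<in> C4} = {0, 2}"
    by (auto simp: C4_def doubleton_eq_iff)
  then show "deg_in C4 {0..<4} 0 = 2" "deg_in C4 {0..<4} 1 = 2"
    "deg_in C4 {0..<4} 2 = 2" "deg_in C4 {0..<4} 3 = 2"
    by (simp_all add: deg_in_def V)
qed

lemma C4_instance: "(4, C4, 0) \<in> lmda_triangle_free_min_deg_2"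
proof -
  have "simple_graph {0..<4} C4" by (auto simp: simple_graph_def C4_def)
  \<comment> \<open>Parity is a proper 2-colouring, which excludes triangles.\<close>
  moreover have "even u \<noteq> even v" if "{u, v} \<in> C4" for u v
    using that by (auto simp: C4_def doubleton_eq_iff)
  then have "triangle_free C4" unfolding triangle_free_def by blast
  moreover have "min_degree_at_least 2 {0..<4} C4"
    unfolding min_degree_at_least_def
  proof
    fix v :: nat assume "v \<in> {0..<4}"
    then have "v = 0 \<or> v = 1 \<or> v = 2 \<or> v = 3" by auto
    then show "2 \<le> deg_in C4 {0..<4} v" using C4_deg_in by auto
  qed
  ultimately show ?thesis by (simp add: lmda_triangle_free_min_deg_2_def)
qed

lemma large_instance_yes:
  assumes "(n, E, k) \<in> lmda_triangle_free_min_deg_2" "0 < n" "k * (4 * k\<^sup>2 + 2) ^ 4 \<le> n"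
  shows "(n, E, k) \<in> lmda_yes"
proof -
  interpret tf_graph "{0..<n}" E
    using assms(1) by unfold_locales (simp_all add: lmda_triangle_free_min_deg_2_def)
  show ?thesis using large_locally_minimal_alliance[of k] assms(2,3) by (simp add: lmda_yes_def)
qed

text \<open>The exponential wins from some \<open>K\<close> on; the finitely many earlier values are
  absorbed by letting \<open>c\<close> be their sum.\<close>

lemma polynomial_le_shifted_exponential:
  obtains c where "\<And>k. k * (4 * k\<^sup>2 + 2) ^ 4 \<le> (2 :: nat) ^ (c + k)"
proof -
  define h :: "nat \<Rightarrow> nat" where "h k = k * (4 * k\<^sup>2 + 2) ^ 4" for k
  have "eventually (\<lambda>k. real k * (4 * (real k)\<^sup>2 + 2) ^ 4 \<le> 2 ^ k) at_top"
    by real_asymp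
  then have "eventually (\<lambda>k. h k \<le> 2 ^ k) at_top"
  proof eventually_elim
    case (elim k)
    then have "real (h k) \<le> real (2 ^ k)" by (simp add: h_def add.commute)
    then show ?case by (simp only: of_nat_le_iff)
  qed
  then obtain K where K: "\<And>k. K \<le> k \<Longrightarrow> h k \<le> 2 ^ k"
    by (auto simp: eventually_at_top_linorder)
  define c where "c = sum h {..<K}"
  have "h k \<le> 2 ^ (c + k)" for k
  proof (cases "K \<le> k")
    case True
    have "(2 :: nat) ^ k \<le> 2 ^ (c + k)" by (intro power_increasing) auto
    then show ?thesis using K[OF True] by linarith
  next
    case False
    then have "h k \<le> c" unfolding c_def by (intro member_le_sum) auto
    also have "c \<le> c + k" by simp
    also have "\<dots> \<le> 2 ^ (c + k)" using less_exp[of "c + k"] by linarith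
    finally show ?thesis .
  qed
  then show ?thesis using that unfolding h_def by blast
qed

theorem theorem5:
  "\<exists>(f :: nat \<Rightarrow> nat) (g :: nat \<Rightarrow> real).
     admits_kernel lmda_triangle_free_min_deg_2 lmda_encode lmda_yes lmda_param lmda_vertices f \<and>
     g \<in> O(\<lambda>k. real k ^ 2) \<and>
     (\<forall>\<^sub>F k in at_top. real (f k) \<le> real k powr g k)"
proof -
  let ?X = lmda_triangle_free_min_deg_2
  obtain c0 where c0: "\<And>k. k * (4 * k\<^sup>2 + 2) ^ 4 \<le> (2 :: nat) ^ (c0 + k)"
    using polynomial_le_shifted_exponential by blast
  \<comment> \<open>The extra 2 ensures \<open>4 \<le> f k\<close>, leaving room for the four
    vertices of \<open>C4\<close>.\<close>
  define c where "c = c0 + 2"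
  have c: "k * (4 * k\<^sup>2 + 2) ^ 4 \<le> (2 :: nat) ^ (c + k)" for k
    using c0[of k] power_increasing[of "c0 + k" "c + k" "2 :: nat"] by (simp add: c_def)
  define f :: "nat \<Rightarrow> nat" where "f k = 2 ^ (c + k)" for k
  define K where
    "K x = (if 2 ^ (c + lmda_param x) \<le> lmda_vertices x then (4, C4, 0) else x)" for x
  have "poly_time_computable_on ?X lmda_encode lmda_encode K"
    unfolding K_def by (rule threshold_poly_time) auto
  moreover have "K x \<in> ?X \<and> (K x \<in> lmda_yes \<longleftrightarrow> x \<in> lmda_yes) \<and>
      lmda_vertices (K x) \<le> f (lmda_param x) \<and> lmda_param (K x) \<le> f (lmda_param x)"
    if x: "x \<in> ?X" for x
  proof -
    obtain n E k where xe: "x = (n, E, k)" by (cases x) auto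
    show ?thesis
    proof (cases "2 ^ (c + k) \<le> n")
      case True
      have "(0 :: nat) < 2 ^ (c + k)" by simp
      with True have "0 < n" by linarith
      moreover have "k * (4 * k\<^sup>2 + 2) ^ 4 \<le> n" using c[of k] True by linarith
      ultimately have "x \<in> lmda_yes" using x xe large_instance_yes by blast
      \<comment> \<open>With parameter 0 the size threshold is 0, so the general result applies to
        \<open>C4\<close> too.\<close>
      moreover have "(4, C4, 0) \<in> lmda_yes"
        by (rule large_instance_yes[OF C4_instance]) auto
      moreover have "4 \<le> f k"
        using power_increasing[of 2 "c + k" "2 :: nat"] by (simp add: f_def c_def)
      ultimately show ?thesis using True C4_instance by (simp add: K_def xe)
    next
      case False
      have "k \<le> f k" unfolding f_def using less_exp[of "c + k"] by linarith
      then show ?thesis using False x by (simp add: K_def xe f_def)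
    qed
  qed
  ultimately have "kernelization ?X lmda_encode lmda_yes lmda_param lmda_vertices f K"
    by (simp add: kernelization_def)
  \<comment> \<open>The exponent is even linear in \<open>k\<close>; replacing the base 2 by
    \<open>k\<close> is sound once \<open>k \<ge> 2\<close>.\<close>
  moreover have "(\<lambda>k. real (c + k)) \<in> O(\<lambda>k. real k ^ 2)"
    unfolding of_nat_add by real_asymp
  moreover have "\<forall>\<^sub>F k in at_top. real (f k) \<le> real k powr real (c + k)"
    using eventually_ge_at_top[of 2]
  proof eventually_elim
    case (elim k)
    then have "real (f k) \<le> real k ^ (c + k)"
      unfolding f_def of_nat_power by (intro power_mono) auto
    also have "\<dots> = real k powr real (c + k)" using elim by (subst powr_realpow) auto
    finally show ?case .
  qed
  ultimately show ?thesis unfolding admits_kernel_def by blast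
qed

end
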